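(* Let $\alpha\in\,]0,1[$. Let $\phi$ be a function from the positive integers to $]0,+\infty[$ and set $\psi(N)=\dfrac{N^{2-\alpha}}{\phi(N)}$ for every integer $N\ge1$. Assume that $\phi(N)\to+\infty$ and $\psi(N)\to+\infty$ as $N\to\infty$, and that $\dfrac{\phi(N)}{N^{1-\alpha}}\to\lambda\in[0,+\infty]$ as $N\to\infty$. For every integer $N\ge 1$ let $$\mathcal{R}_N^{\alpha}=\frac{1}{\psi(N)}\sum_{1\le n\ne m\le N}\Delta_{\phi(N)(n^\alpha-m^\alpha)} .$$ Then, as $N\to\infty$, the positive measures $\mathcal{R}_N^{\alpha}$ converge vaguely on $\mathbb{R}$ to the measure $\rho_\alpha\,\mathrm{Leb}_{\mathbb{R}}$, where $\rho_\alpha:\mathbb{R}\to\mathbb{R}_+$ is the measurable nonnegative function given by $$\rho_\alpha(t)=\begin{cases}0 & \text{if } \lambda=+\infty,\\[2mm] \dfrac{1}{\alpha(2-\alpha)} & \text{if } \lambda=0,\\[3mm] \dfrac{\alpha^{\frac{1}{1-\alpha}}}{1-\alpha}\Big(\dfrac{|t|}{\lambda}\Big)^{-\frac{2-\alpha}{1-\alpha}}\displaystyle\sum_{p=1}^{\lfloor |t|/(\alpha\lambda)\rfloor}p^{\frac{1}{1-\alpha}} & \text{if } 0<\lambda<+\infty.\end{cases}$$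
   Context: $\Delta_x$ denotes the unit Dirac mass at $x\in\mathbb{R}$; $\mathrm{Leb}_{\mathbb{R}}$ is the Lebesgue measure on $\mathbb{R}$; $\lfloor\cdot\rfloor$ is the lower integer part; $\mathbb{R}_+=[0,+\infty[$. The function $\phi$ is called the scaling factor and $\psi$ the renormalization factor. The sum over $1\le n\ne m\le N$ runs over all ordered pairs $(n,m)$ of distinct integers in $\{1,\dots,N\}$. A sequence of positive measures $(\mu_N)_N$ on $\mathbb{R}$ converges vaguely to a positive measure $\mu$ if $\mu_N(f)\to\mu(f)$ for every continuous compactly supported function $f:\mathbb{R}\to\mathbb{C}$, where $\mu(f)=\int f\,d\mu$. Convention: an empty sum is $0$, so in the case $0<\lambda<+\infty$ the function $\rho_\alpha$ vanishes for $|t|<\alpha\lambda$ (including at $t=0$). *)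

theory Defs
  imports "HOL-Probability.Probability"
begin

definition renorm_factor :: "real \<Rightarrow> (nat \<Rightarrow> real) \<Rightarrow> nat \<Rightarrow> real" where
  "renorm_factor \<alpha> \<phi> N = real N powr (2 - \<alpha>) / \<phi> N"

text \<open>\<^term>\<open>return borel y\<close> is the unit Dirac mass at \<^term>\<open>y\<close>.\<close>

definition dirac_sum :: "'i set \<Rightarrow> ('i \<Rightarrow> real) \<Rightarrow> real measure" where
  "dirac_sum I x = measure_of UNIV (sets borel) (\<lambda>A. \<Sum>i\<in>I. emeasure (return borel (x i)) A)"

lemma sets_dirac_sum [simp, measurable_cong]: "sets (dirac_sum I x) = sets borel"
  unfolding dirac_sum_def
  by (metis sets.sets_measure_of_eq space_borel)

lemma space_dirac_sum [simp]: "space (dirac_sum I x) = UNIV"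
  by (simp add: dirac_sum_def space_measure_of_conv)

lemma emeasure_dirac_sum:
  assumes "A \<in> sets borel"
  shows "emeasure (dirac_sum I x) A = (\<Sum>i\<in>I. emeasure (return borel (x i)) A)"
proof (rule emeasure_measure_of[OF dirac_sum_def])
  show "countably_additive (sets (dirac_sum I x)) (\<lambda>A. \<Sum>i\<in>I. emeasure (return borel (x i)) A)"
  proof (rule countably_additiveI)
    fix B :: "nat \<Rightarrow> real set"
    assume B: "range B \<subseteq> sets (dirac_sum I x)" "disjoint_family B"
    have "(\<Sum>k. \<Sum>i\<in>I. emeasure (return borel (x i)) (B k))
        = (\<Sum>i\<in>I. \<Sum>k. emeasure (return borel (x i)) (B k))"
      by (rule suminf_sum) simp
    also have "\<dots> = (\<Sum>i\<in>I. emeasure (return borel (x i)) (\<Union>k. B k))"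
      by (rule sum.cong[OF refl], rule suminf_emeasure) (use B in auto)
    finally show "(\<Sum>k. \<Sum>i\<in>I. emeasure (return borel (x i)) (B k))
        = (\<Sum>i\<in>I. emeasure (return borel (x i)) (\<Union>k. B k))" .
  qed
qed (use assms in \<open>auto simp: positive_def\<close>)

definition pair_corr_measure :: "real \<Rightarrow> (nat \<Rightarrow> real) \<Rightarrow> nat \<Rightarrow> real measure" where
  "pair_corr_measure \<alpha> \<phi> N =
     scale_measure (ennreal (1 / renorm_factor \<alpha> \<phi> N))
       (dirac_sum {(n, m). n \<in> {1..N} \<and> m \<in> {1..N} \<and> n \<noteq> m}
          (\<lambda>(n, m). \<phi> N * (real n powr \<alpha> - real m powr \<alpha>)))"

text \<open>
  Vague convergence is between Borel measures against which every test function is integrable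
  (that is, Radon measures). Integrability is required explicitly because the Bochner
  integral of a non-integrable function is \<^term>\<open>0\<close> by convention.
\<close>

definition vaguely_converges :: "(nat \<Rightarrow> real measure) \<Rightarrow> real measure \<Rightarrow> bool" where
  "vaguely_converges \<mu> \<nu> \<longleftrightarrow>
     (\<forall>N. sets (\<mu> N) = sets borel) \<and> sets \<nu> = sets borel \<and>
     (\<forall>f :: real \<Rightarrow> complex.
        continuous_on UNIV f \<and> compact (closure {x. f x \<noteq> 0}) \<longrightarrow>
        (\<forall>N. integrable (\<mu> N) f) \<and> integrable \<nu> f \<and>
        (\<lambda>N. integral\<^sup>L (\<mu> N) f) \<longlonglongrightarrow> integral\<^sup>L \<nu> f)"

text \<open>
  In the last case the sum is empty for \<open>\<bar>t\<bar> < \<alpha> * l\<close>, so the value is \<^term>\<open>0\<close> there,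
  in particular at \<open>t = 0\<close>.
\<close>

definition rho :: "real \<Rightarrow> ennreal \<Rightarrow> real \<Rightarrow> real" where
  "rho \<alpha> lam t =
     (if lam = \<infinity> then 0
      else if lam = 0 then 1 / (\<alpha> * (2 - \<alpha>))
      else (let l = enn2real lam in
        \<alpha> powr (1 / (1 - \<alpha>)) / (1 - \<alpha>) * (\<bar>t\<bar> / l) powr (- ((2 - \<alpha>) / (1 - \<alpha>)))
        * (\<Sum>p = 1..nat \<lfloor>\<bar>t\<bar> / (\<alpha> * l)\<rfloor>. real p powr (1 / (1 - \<alpha>)))))"

end

theory Submission
  imports Defs
begin

text \<open>
  Put \<open>\<epsilon> = \<phi> N / N powr (1 - \<alpha>)\<close>, so that the normalisation \<open>1 / \<psi> N\<close> is \<open>\<epsilon> / N\<close>. By symmetry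
  it suffices to treat the pairs with \<open>m < n\<close>, written \<open>(m + p, m)\<close> with a gap \<open>p \<ge> 1\<close>. Since
  \<open>\<epsilon> / N\<close> is the area of a rectangle with sides \<open>\<epsilon>\<close> and \<open>1 / N\<close>, the normalised sum of \<open>f\<close> over
  these pairs is an integral over the strip \<open>{0<..} \<times> {0<..1}\<close> of the function that takes, at
  \<open>(s, x)\<close>, the value of the term with \<open>p = \<lceil>s / \<epsilon>\<rceil>\<close> and \<open>m = \<lceil>x N\<rceil>\<close>
  (lemma \<open>integral_strip_cells\<close>).

  By the mean value theorem, \<open>\<phi> N * ((m + p) powr \<alpha> - m powr \<alpha>) = \<alpha> * (\<epsilon> * p) * \<xi> powr (\<alpha> - 1)\<close>
  for some \<open>\<xi>\<close> between \<open>m / N\<close> and \<open>(m + p) / N\<close>. When \<open>\<epsilon>\<close> has a finite limit \<open>l\<close>, the point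
  \<open>\<xi>\<close> tends to \<open>x\<close> and \<open>\<epsilon> * \<lceil>s / \<epsilon>\<rceil>\<close> tends, for almost all \<open>s\<close>, to \<open>h s\<close>, which is \<open>s\<close> if
  \<open>l = 0\<close> and \<open>l * \<lceil>s / l\<rceil>\<close> if \<open>l > 0\<close>. As \<open>\<xi> \<le> 1\<close>, this difference is at least \<open>\<alpha> * s\<close>,
  so the integrands are dominated on a fixed bounded rectangle, and the sums converge to the integral of
  \<open>f (\<alpha> * h s * x powr (\<alpha> - 1))\<close> over the strip (lemma \<open>integral_cells_tendsto\<close>). When
  \<open>\<epsilon>\<close> tends to infinity, every such difference is at least \<open>\<alpha> * \<epsilon>\<close> and the sums are eventually \<open>0\<close>.

  It remains to identify the image of Lebesgue measure on the strip under
  \<open>(s, x) \<mapsto> \<alpha> * h s * x powr (\<alpha> - 1)\<close>. For fixed \<open>s\<close> the image of the uniform measure in \<open>x\<close>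
  is a Pareto law, and mixing these laws over \<open>s\<close> gives a density that is explicit for both
  shapes of \<open>h\<close> (lemmas \<open>distr_strip_eq_density\<close>, \<open>level_integral_linear\<close> and
  \<open>level_integral_step\<close>): the constant density comes from \<open>h s = s\<close>, and the finite sum in
  \<^const>\<open>rho\<close> from the finitely many steps of \<open>h\<close> below a given level.
\<close>

section \<open>Integrals against the pair correlation measures\<close>

text \<open>
  As an image of a counting measure, the sum of Dirac masses inherits the change of variables
  rules for Bochner integrals.
\<close>

lemma dirac_sum_eq_distr:
  assumes "finite I"
  shows "dirac_sum I x = distr (count_space I) borel x"
proof (rule measure_eqI)
  fix A assume "A \<in> sets (dirac_sum I x)"
  then have A: "A \<in> sets borel" by simp
  have "emeasure (dirac_sum I x) A = (\<Sum>i\<in>I. indicator A (x i))"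
    using A by (simp add: emeasure_dirac_sum)
  also have "\<dots> = of_nat (card (x -` A \<inter> I))"
    using assms by (simp add: indicator_def sum.If_cases Int_commute vimage_def)
  also have "\<dots> = emeasure (distr (count_space I) borel x) A"
    using A assms by (simp add: emeasure_distr emeasure_count_space)
  finally show "emeasure (dirac_sum I x) A = emeasure (distr (count_space I) borel x) A" .
qed simp

lemma scale_measure_eq_density: "scale_measure c M = density M (\<lambda>_. c)"
  by (rule measure_eqI) (auto simp: emeasure_density nn_integral_cmult_indicator)

lemma integral_pair_corr_measure:
  fixes f :: "real \<Rightarrow> complex"
  assumes f [measurable]: "f \<in> borel_measurable borel" and pos: "0 \<le> renorm_factor \<alpha> \<phi> N"
  defines "I \<equiv> {(n, m). n \<in> {1..N} \<and> m \<in> {1..N} \<and> n \<noteq> m}"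
  shows "integrable (pair_corr_measure \<alpha> \<phi> N) f"
    and "integral\<^sup>L (pair_corr_measure \<alpha> \<phi> N) f =
      (1 / renorm_factor \<alpha> \<phi> N) *\<^sub>R
        (\<Sum>(n, m)\<in>I. f (\<phi> N * (real n powr \<alpha> - real m powr \<alpha>)))"
proof -
  have I: "finite I"
    unfolding I_def by (rule finite_subset[of _ "{1..N} \<times> {1..N}"]) auto
  have M: "pair_corr_measure \<alpha> \<phi> N = density (distr (count_space I) borel
      (\<lambda>(n, m). \<phi> N * (real n powr \<alpha> - real m powr \<alpha>))) (\<lambda>_. ennreal (1 / renorm_factor \<alpha> \<phi> N))"
    unfolding pair_corr_measure_def scale_measure_eq_density I_def[symmetric]
    by (simp only: dirac_sum_eq_distr[OF I])
  show "integrable (pair_corr_measure \<alpha> \<phi> N) f"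
    unfolding M using pos
    by (subst integrable_density; (simp add: I integrable_distr_eq integrable_count_space)?)
  show "integral\<^sup>L (pair_corr_measure \<alpha> \<phi> N) f = (1 / renorm_factor \<alpha> \<phi> N) *\<^sub>R
        (\<Sum>(n, m)\<in>I. f (\<phi> N * (real n powr \<alpha> - real m powr \<alpha>)))"
    unfolding M using pos
    by (subst integral_density; 
        (simp add: I integral_distr lebesgue_integral_count_space_finite case_prod_unfold)?)
qed

section \<open>The strip of rescaled indices\<close>

text \<open>
  The gap \<open>p\<close> and the smaller index \<open>m\<close> of a pair \<open>(m + p, m)\<close>
  become, after rescaling, the coordinates \<open>s = \<epsilon> p\<close> and \<open>x = m / N\<close>.
\<close>

definition strip :: "(real \<times> real) measure" where
  "strip = restrict_space lborel ({0<..} \<times> {0<..1})"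

lemma strip_set_borel [measurable]: "{0<..} \<times> {0<..1::real} \<in> sets (borel :: (real \<times> real) measure)"
  by (intro borel_Times) auto

lemma space_strip: "space strip = {0<..} \<times> {0<..1}"
  by (simp add: strip_def space_restrict_space)

lemma borel_measurable_strip:
  "f \<in> borel_measurable borel \<Longrightarrow> f \<in> borel_measurable strip"
  by (simp add: strip_def measurable_restrict_space1)

lemma nn_integral_strip:
  assumes f: "f \<in> borel_measurable borel"
  shows "(\<integral>\<^sup>+z. f z \<partial>strip) =
    (\<integral>\<^sup>+s. (\<integral>\<^sup>+x. f (s, x) * indicator {0<..1} x \<partial>lborel) * indicator {0<..} s \<partial>lborel)"
proof -
  have m: "(\<lambda>z. f z * indicator ({0<..} \<times> {0<..1}) z) \<in> borel_measurable (lborel \<Otimes>\<^sub>M lborel)"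
    unfolding lborel_prod using f by simp
  have "(\<integral>\<^sup>+z. f z \<partial>strip) = (\<integral>\<^sup>+z. f z * indicator ({0<..} \<times> {0<..1}) z \<partial>(lborel \<Otimes>\<^sub>M lborel))"
    unfolding strip_def lborel_prod by (subst nn_integral_restrict_space) simp_all
  also have "\<dots> = (\<integral>\<^sup>+s. \<integral>\<^sup>+x. f (s, x) * indicator ({0<..} \<times> {0<..1}) (s, x) \<partial>lborel \<partial>lborel)"
    by (rule lborel.nn_integral_fst[OF m, symmetric])
  also have "\<dots> = (\<integral>\<^sup>+s. (\<integral>\<^sup>+x. f (s, x) * indicator {0<..1} x \<partial>lborel) * indicator {0<..} s \<partial>lborel)"
    by (intro nn_integral_cong) (simp add: indicator_def)
  finally show ?thesis .
qed

lemma emeasure_strip_rectangle: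
  assumes "0 \<le> p" "p \<le> q" "0 \<le> u" "u \<le> v" "v \<le> 1"
  shows "emeasure strip ({p<..q} \<times> {u<..v}) = ennreal ((q - p) * (v - u))"
proof -
  have "emeasure strip ({p<..q} \<times> {u<..v}) = emeasure (lborel \<Otimes>\<^sub>M lborel) ({p<..q} \<times> {u<..v})"
    unfolding strip_def lborel_prod 
    by (rule emeasure_restrict_space) (use assms in auto)
  also have "\<dots> = ennreal ((q - p) * (v - u))"
    by (subst lborel.emeasure_pair_measure_Times) (use assms in \<open>auto simp: ennreal_mult\<close>)
  finally show ?thesis .
qed

text \<open>
  This turns a double sum into an integral over a domain independent of \<open>N\<close>, which is what
  dominated convergence needs: the half-open rectangle of side lengths \<open>e\<close> and \<open>1 / N\<close> whose
  upper right corner is \<open>(e p, m / N)\<close> is exactly the set where the two ceilings are \<open>p\<close>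
  and \<open>m\<close>. Half-open cells closed on the right, hence ceilings, keep \<open>p\<close> and \<open>m\<close> at least \<open>1\<close>.
\<close>

lemma integral_strip_cells:
  fixes G :: "nat \<Rightarrow> nat \<Rightarrow> complex"
  assumes e: "0 < e" and N: "0 < N" and G: "\<And>p m. p > N \<Longrightarrow> G p m = 0"
  shows "integrable strip (\<lambda>(s, x). G (nat \<lceil>s / e\<rceil>) (nat \<lceil>x * real N\<rceil>))" (is "integrable _ ?u")
    and "integral\<^sup>L strip (\<lambda>(s, x). G (nat \<lceil>s / e\<rceil>) (nat \<lceil>x * real N\<rceil>)) =
    (e / real N) *\<^sub>R (\<Sum>p=1..N. \<Sum>m=1..N. G p m)"
proof -
  define C where "C p m = {(real p - 1) * e<..real p * e} \<times> {(real m - 1) / real N<..real m / real N}" for p m :: nat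
  have em: "emeasure strip (C p m) = ennreal (e / real N)" if "p \<in> {1..N}" "m \<in> {1..N}" for p m
    unfolding C_def using that e N
    by (subst emeasure_strip_rectangle) (auto simp: field_simps)
  have sets: "C p m \<in> sets strip" if "p \<in> {1..N}" "m \<in> {1..N}" for p m
    using em[OF that] e N by (intro emeasure_neq_0_sets) auto
  have eq: "G (nat \<lceil>s / e\<rceil>) (nat \<lceil>x * real N\<rceil>) =
      (\<Sum>p=1..N. \<Sum>m=1..N. indicator (C p m) (s, x) *\<^sub>R G p m)" if "s > 0" "0 < x" "x \<le> 1" for s x
  proof -
    have s: "((real p - 1) * e < s \<and> s \<le> real p * e) \<longleftrightarrow> p = nat \<lceil>s / e\<rceil>" if "p \<in> {1..N}" for p
    proof -
      have "p = nat \<lceil>s / e\<rceil> \<longleftrightarrow> \<lceil>s / e\<rceil> = int p" using that \<open>s > 0\<close> e by auto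
      also have "\<dots> \<longleftrightarrow> real p - 1 < s / e \<and> s / e \<le> real p" by (simp add: ceiling_eq_iff)
      also have "\<dots> \<longleftrightarrow> (real p - 1) * e < s \<and> s \<le> real p * e" using e by (simp add: field_simps)
      finally show ?thesis by simp
    qed
    have x: "((real m - 1) / real N < x \<and> x \<le> real m / real N) \<longleftrightarrow> m = nat \<lceil>x * real N\<rceil>" if "m \<in> {1..N}" for m
    proof -
      have "m = nat \<lceil>x * real N\<rceil> \<longleftrightarrow> \<lceil>x * real N\<rceil> = int m" using that \<open>x > 0\<close> N by auto
      also have "\<dots> \<longleftrightarrow> real m - 1 < x * real N \<and> x * real N \<le> real m" by (simp add: ceiling_eq_iff)
      also have "\<dots> \<longleftrightarrow> (real m - 1) / real N < x \<and> x \<le> real m / real N" using N by (simp add: field_simps)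
      finally show ?thesis by simp
    qed
    have m1: "nat \<lceil>x * real N\<rceil> \<in> {1..N}"
    proof -
      have "0 < x * real N" "x * real N \<le> real N" using that N by (auto simp: mult_le_cancel_right1)
      then have "0 < \<lceil>x * real N\<rceil>" "\<lceil>x * real N\<rceil> \<le> int N" by linarith+
      then show ?thesis unfolding atLeastAtMost_iff by linarith
    qed
    have p1: "1 \<le> nat \<lceil>s / e\<rceil>"
    proof -
      have "0 < s / e" using that e by simp
      then have "0 < \<lceil>s / e\<rceil>" by linarith
      then show ?thesis by linarith
    qed
    have "(\<Sum>p=1..N. \<Sum>m=1..N. indicator (C p m) (s, x) *\<^sub>R G p m)
      = (\<Sum>p=1..N. \<Sum>m=1..N. if m = nat \<lceil>x * real N\<rceil> then (if p = nat \<lceil>s / e\<rceil> then G p m else 0) else 0)"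
      by (intro sum.cong refl) (auto simp: C_def indicator_def s x)
    also have "\<dots> = (if nat \<lceil>s / e\<rceil> \<le> N then G (nat \<lceil>s / e\<rceil>) (nat \<lceil>x * real N\<rceil>) else 0)"
      using m1 p1 by (simp add: sum.delta)
    also have "\<dots> = G (nat \<lceil>s / e\<rceil>) (nat \<lceil>x * real N\<rceil>)"
      by (cases "nat \<lceil>s / e\<rceil> \<le> N") (simp_all only: G not_le if_True if_False if_not_P)
    finally show ?thesis by simp
  qed
  have i: "integrable strip (\<lambda>z. indicator (C p m) z *\<^sub>R G p m)" if "p \<in> {1..N}" "m \<in> {1..N}" for p m
    using sets[OF that] em[OF that] by (intro integrable_scaleR_left integrable_real_indicator) auto
  have v: "integral\<^sup>L strip (\<lambda>z. indicator (C p m) z *\<^sub>R G p m) = (e / real N) *\<^sub>R G p m"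
    if "p \<in> {1..N}" "m \<in> {1..N}" for p m
    using sets[OF that] em[OF that] e N by (simp add: measure_def)
  have cong: "?u z = (\<Sum>p=1..N. \<Sum>m=1..N. indicator (C p m) z *\<^sub>R G p m)" if "z \<in> space strip" for z
    using that by (auto simp: space_strip eq)
  have "integrable strip (\<lambda>z. \<Sum>p=1..N. \<Sum>m=1..N. indicator (C p m) z *\<^sub>R G p m)"
    by (intro Bochner_Integration.integrable_sum i)
  also have "?this \<longleftrightarrow> integrable strip ?u"
    by (rule Bochner_Integration.integrable_cong[OF refl, symmetric]) (rule cong)
  finally show "integrable strip ?u" .
  have "integral\<^sup>L strip ?u = integral\<^sup>L strip (\<lambda>z. \<Sum>p=1..N. \<Sum>m=1..N. indicator (C p m) z *\<^sub>R G p m)"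
    by (rule Bochner_Integration.integral_cong[OF refl]) (rule cong)
  also have "\<dots> = (\<Sum>p=1..N. \<Sum>m=1..N. (e / real N) *\<^sub>R G p m)"
    by (subst Bochner_Integration.integral_sum, intro Bochner_Integration.integrable_sum i, assumption+)
      (intro sum.cong refl, subst Bochner_Integration.integral_sum, auto intro!: i sum.cong simp: v)
  finally show "integral\<^sup>L strip ?u = (e / real N) *\<^sub>R (\<Sum>p=1..N. \<Sum>m=1..N. G p m)"
    by (simp add: scaleR_sum_right)
qed

section \<open>The image of Lebesgue measure on the strip\<close>

lemma nn_integral_powr_tail:
  fixes e :: real
  assumes "e < -1" "0 < d" "0 \<le> k"
  shows "(\<integral>\<^sup>+t. ennreal (k * t powr e) * indicator {d..} t \<partial>lborel) = ennreal (k * d powr (e + 1) / (- e - 1))"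
proof -
  have "((\<lambda>t. k * t powr e) has_integral k * (- (d powr (e + 1)) / (e + 1))) {d..}"
    by (intro has_integral_mult_right has_integral_powr_to_inf assms)
  then have "(\<integral>\<^sup>+t. ennreal (k * t powr e) * indicator {d..} t \<partial>lborel) = ennreal (k * (- (d powr (e + 1)) / (e + 1)))"
    using assms by (intro nn_integral_has_integral_lebesgue') auto
  also have "k * (- (d powr (e + 1)) / (e + 1)) = k * d powr (e + 1) / (- e - 1)"
    using assms by (simp add: divide_simps) (simp add: algebra_simps)
  finally show ?thesis .
qed

text \<open>
  A negative power of a uniform variable has a Pareto law; both measures give \<open>{y<..}\<close> the mass
  \<open>(c / max c y) powr (1 / b)\<close>, and such half-lines determine a finite measure.
\<close>

lemma distr_uniform_powr:
  fixes b c :: real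
  assumes b: "0 < b" and c: "0 < c"
  shows "distr (restrict_space lborel {0<..1}) borel (\<lambda>x. c * x powr (- b)) =
    density lborel (\<lambda>t. ennreal (1 / b * c powr (1 / b) * t powr (- 1 / b - 1)) * indicator {c..} t)"
    (is "?M = density lborel ?q")
proof -
  have T [measurable]: "(\<lambda>x. c * x powr (- b)) \<in> borel_measurable (restrict_space lborel {0<..1})"
    by (intro measurable_restrict_space1) measurable
  have M: "emeasure ?M {y<..} = ennreal ((c / max c y) powr (1 / b))" for y
  proof (cases "y < c")
    case True
    have "y < c * x powr (- b)" if "0 < x" "x \<le> 1" for x
    proof -
      have "1 \<le> x powr (- b)"
        using that b powr_le1[of b x] by (simp add: powr_minus one_le_inverse_iff)
      then have "c * 1 \<le> c * x powr (- b)"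
        using c by (intro mult_left_mono) auto
      then show ?thesis using True by simp
    qed
    then have "(\<lambda>x. c * x powr (- b)) -` {y<..} \<inter> space (restrict_space lborel {0<..1}) = {0<..1}"
      by (auto simp: space_restrict_space)
    then have "emeasure ?M {y<..} = emeasure (restrict_space lborel {0<..1::real}) {0<..1}"
      by (subst emeasure_distr) auto
    also have "\<dots> = 1" by (subst emeasure_restrict_space) auto
    finally show ?thesis using True c by (simp add: max_def)
  next
    case False
    define r where "r = (c / y) powr (1 / b)"
    have y: "0 < y" using False c by simp
    have r: "0 < r" "r \<le> 1" unfolding r_def using False c b y
      by (auto intro!: powr_le1)
    have "y < c * x powr (- b) \<longleftrightarrow> x < r" if "0 < x" for x
    proof -
      have "y < c * x powr (- b) \<longleftrightarrow> x powr b < c / y"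
        using that c y by (simp add: powr_minus field_simps)
      also have "c / y = r powr b" using b c y by (simp add: r_def powr_powr)
      also have "x powr b < r powr b \<longleftrightarrow> x < r"
        using that r b powr_less_mono2[of b x r] powr_mono2[of b r x] by (smt (verit))
      finally show ?thesis .
    qed
    then have "(\<lambda>x. c * x powr (- b)) -` {y<..} \<inter> space (restrict_space lborel {0<..1}) = {0<..<r}"
      using r by (auto simp: space_restrict_space)
    then have "emeasure ?M {y<..} = emeasure (restrict_space lborel {0<..1::real}) {0<..<r}"
      by (subst emeasure_distr) auto
    also have "\<dots> = ennreal r" using r by (subst emeasure_restrict_space) auto
    finally show ?thesis using False c by (simp add: max_def r_def)
  qed
  have N: "emeasure (density lborel ?q) {y<..} = ennreal ((c / max c y) powr (1 / b))" for y
  proof -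
    define d where "d = max c y"
    have d: "0 < d" using c by (simp add: d_def)
    have "emeasure (density lborel ?q) {y<..} = (\<integral>\<^sup>+t. ?q t * indicator {y<..} t \<partial>lborel)"
      by (subst emeasure_density) auto
    also have "\<dots> = (\<integral>\<^sup>+t. ennreal (1 / b * c powr (1 / b) * t powr (- 1 / b - 1)) * indicator {d..} t \<partial>lborel)"
    proof (rule nn_integral_cong_AE, rule AE_mp[OF AE_lborel_singleton[of y]], rule AE_I2, rule impI)
      fix t assume "t \<noteq> y"
      then have i: "indicator {d..} t = (indicator {c..} t * indicator {y<..} t :: ennreal)"
        by (auto simp: d_def indicator_def)
      show "?q t * indicator {y<..} t
        = ennreal (1 / b * c powr (1 / b) * t powr (- 1 / b - 1)) * indicator {d..} t"
        unfolding i by (simp only: mult.assoc)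
    qed
    also have "\<dots> = ennreal (1 / b * c powr (1 / b) * d powr (- 1 / b - 1 + 1) / (- (- 1 / b - 1) - 1))"
      using b c d by (intro nn_integral_powr_tail) auto
    also have "1 / b * c powr (1 / b) * d powr (- 1 / b - 1 + 1) / (- (- 1 / b - 1) - 1) = (c / d) powr (1 / b)"
      using b c d by (simp add: powr_divide powr_minus divide_simps)
    finally show ?thesis by (simp add: d_def)
  qed
  show ?thesis
  proof (rule measure_eqI_lessThan)
    show "emeasure ?M {y<..} < \<infinity>" for y by (simp only: M) simp
    show "emeasure ?M {y<..} = emeasure (density lborel ?q) {y<..}" for y by (simp only: M N)
  qed simp_all
qed

lemma nn_integral_uniform_powr:
  fixes b c :: real
  assumes b: "0 < b" and c: "0 < c" and f [measurable]: "f \<in> borel_measurable borel"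
  shows "(\<integral>\<^sup>+x. f (c * x powr (- b)) * indicator {0<..1} x \<partial>lborel) =
    (\<integral>\<^sup>+t. f t * (ennreal (1 / b * c powr (1 / b) * t powr (- 1 / b - 1)) * indicator {c..} t) \<partial>lborel)"
proof -
  have T [measurable]: "(\<lambda>x. c * x powr (- b)) \<in> borel_measurable (restrict_space lborel {0<..1})"
    by (intro measurable_restrict_space1) measurable
  have "(\<integral>\<^sup>+x. f (c * x powr (- b)) * indicator {0<..1} x \<partial>lborel) =
      (\<integral>\<^sup>+t. f t \<partial>distr (restrict_space lborel {0<..1}) borel (\<lambda>x. c * x powr (- b)))"
    by (simp add: nn_integral_distr nn_integral_restrict_space)
  then show ?thesis
    unfolding distr_uniform_powr[OF b c]
    by (simp add: nn_integral_density mult.commute)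
qed

text \<open>
  For fixed \<open>s\<close> the variable \<open>x\<close> is uniform, so \<open>a * h s * x powr (a - 1)\<close> has a Pareto
  density, supported on \<open>{a * h s..}\<close>. Exchanging the order of integration in \<open>s\<close> and \<open>t\<close>
  leaves, as density at \<open>t\<close>, a power of \<open>t\<close> times the integral of \<open>(a * h s) powr (1 / (1 - a))\<close>
  over the level set \<open>{s. 0 < s \<and> a * h s \<le> t}\<close>. Only this last integral depends on the regime, so it is kept
  as the hypothesis \<open>level\<close>.
\<close>

lemma distr_strip_eq_density:
  fixes a :: real and h R :: "real \<Rightarrow> real"
  assumes a: "0 < a" "a < 1"
    and h [measurable]: "h \<in> borel_measurable borel" and hpos: "\<And>s. 0 < s \<Longrightarrow> 0 < h s"
    and R [measurable]: "R \<in> borel_measurable borel"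
    and level: "\<And>t. 0 < t \<Longrightarrow>
      (\<integral>\<^sup>+s. ennreal ((a * h s) powr (1 / (1 - a))) * indicator {s. 0 < s \<and> a * h s \<le> t} s \<partial>lborel)
       = ennreal ((1 - a) * t powr ((2 - a) / (1 - a)) * R t)"
  shows "distr strip borel (\<lambda>(s, x). a * h s * x powr (a - 1)) =
    density lborel (\<lambda>t. ennreal (R t) * indicator {0<..} t)" (is "distr strip borel ?T = _")
proof (rule measure_eqI)
  have T: "?T \<in> borel_measurable borel"
    unfolding borel_prod[symmetric] by measurable
  note T' = borel_measurable_strip[OF T]
  fix A assume "A \<in> sets (distr strip borel ?T)"
  then have A [measurable]: "A \<in> sets borel" by simp
  define g where "g = 1 / (1 - a)"
  have e: "- 1 / (1 - a) - 1 = - ((2 - a) / (1 - a))" using a by (simp add: field_simps)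
  have "emeasure (distr strip borel ?T) A = (\<integral>\<^sup>+z. indicator A (?T z) \<partial>strip)"
    using T' A by (simp add: nn_integral_indicator[symmetric] nn_integral_distr del: nn_integral_indicator)
  also have "\<dots> = (\<integral>\<^sup>+s. (\<integral>\<^sup>+x. indicator A (a * h s * x powr (a - 1)) * indicator {0<..1} x \<partial>lborel) * indicator {0<..} s \<partial>lborel)"
    using T by (subst nn_integral_strip) auto
  also have "\<dots> = (\<integral>\<^sup>+s. (\<integral>\<^sup>+t. indicator A t * (ennreal (g * (a * h s) powr g * t powr (- ((2 - a) / (1 - a))))
      * indicator {a * h s..} t) \<partial>lborel) * indicator {0<..} s \<partial>lborel)"
  proof (intro nn_integral_cong)
    fix s :: real
    show "(\<integral>\<^sup>+x. indicator A (a * h s * x powr (a - 1)) * indicator {0<..1} x \<partial>lborel) * indicator {0<..} s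
      = (\<integral>\<^sup>+t. indicator A t * (ennreal (g * (a * h s) powr g * t powr (- ((2 - a) / (1 - a))))
      * indicator {a * h s..} t) \<partial>lborel) * indicator {0<..} s"
      using nn_integral_uniform_powr[of "1 - a" "a * h s" "indicator A", unfolded e] a hpos[of s]
      by (cases "0 < s") (auto simp: g_def)
  qed
  also have "\<dots> = (\<integral>\<^sup>+s. \<integral>\<^sup>+t. indicator A t * (ennreal (g * (a * h s) powr g * t powr (- ((2 - a) / (1 - a))))
      * indicator {a * h s..} t) * indicator {0<..} s \<partial>lborel \<partial>lborel)"
    by (intro nn_integral_cong nn_integral_multc[symmetric]) measurable
  also have "\<dots> = (\<integral>\<^sup>+t. \<integral>\<^sup>+s. indicator A t * (ennreal (g * (a * h s) powr g * t powr (- ((2 - a) / (1 - a))))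
      * indicator {a * h s..} t) * indicator {0<..} s \<partial>lborel \<partial>lborel)"
    by (rule lborel_pair.Fubini'[symmetric]) (auto simp: indicator_def)
  also have "\<dots> = (\<integral>\<^sup>+t. ennreal (R t) * indicator {0<..} t * indicator A t \<partial>lborel)"
  proof (intro nn_integral_cong)
    fix t :: real
    have "(\<integral>\<^sup>+s. indicator A t * (ennreal (g * (a * h s) powr g * t powr (- ((2 - a) / (1 - a))))
      * indicator {a * h s..} t) * indicator {0<..} s \<partial>lborel) = 
      (\<integral>\<^sup>+s. indicator A t * indicator {0<..} t * ennreal (g * t powr (- ((2 - a) / (1 - a)))) * 
        (ennreal ((a * h s) powr g) * indicator {s. 0 < s \<and> a * h s \<le> t} s) \<partial>lborel)"
    proof (intro nn_integral_cong)
      fix s :: real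
      have "\<not> (0 < s \<and> a * h s \<le> t)" if "t \<le> 0"
        using that hpos[of s] a by (auto simp: not_le intro: le_less_trans)
      then show "indicator A t * (ennreal (g * (a * h s) powr g * t powr (- ((2 - a) / (1 - a)))) * indicator {a * h s..} t) 
        * indicator {0<..} s
        = indicator A t * indicator {0<..} t * ennreal (g * t powr (- ((2 - a) / (1 - a)))) * 
        (ennreal ((a * h s) powr g) * indicator {s. 0 < s \<and> a * h s \<le> t} s)"
        using a by (auto simp: indicator_def g_def mult_ac simp flip: ennreal_mult)
    qed
    also have "\<dots> = indicator A t * indicator {0<..} t * ennreal (g * t powr (- ((2 - a) / (1 - a)))) * 
        (\<integral>\<^sup>+s. ennreal ((a * h s) powr g) * indicator {s. 0 < s \<and> a * h s \<le> t} s \<partial>lborel)"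
      by (rule nn_integral_cmult) measurable
    also have "\<dots> = ennreal (R t) * indicator {0<..} t * indicator A t"
    proof (cases "0 < t")
      case True
      have "ennreal (g * t powr (- ((2 - a) / (1 - a)))) * ennreal ((1 - a) * t powr ((2 - a) / (1 - a)) * R t)
        = ennreal (g * t powr (- ((2 - a) / (1 - a))) * ((1 - a) * t powr ((2 - a) / (1 - a)) * R t))"
        using a by (intro ennreal_mult'[symmetric]) (auto simp: g_def)
      also have "g * t powr (- ((2 - a) / (1 - a))) * ((1 - a) * t powr ((2 - a) / (1 - a)) * R t) = R t"
        using a True by (simp add: g_def powr_minus field_simps)
      finally show ?thesis
        using True level[OF True] by (simp add: g_def mult_ac)
    qed simp
    finally show "(\<integral>\<^sup>+s. indicator A t * (ennreal (g * (a * h s) powr g * t powr (- ((2 - a) / (1 - a))))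
      * indicator {a * h s..} t) * indicator {0<..} s \<partial>lborel) = ennreal (R t) * indicator {0<..} t * indicator A t" .
  qed
  also have "\<dots> = emeasure (density lborel (\<lambda>t. ennreal (R t) * indicator {0<..} t)) A"
    by (subst emeasure_density) auto
  finally show "emeasure (distr strip borel ?T) A = emeasure (density lborel (\<lambda>t. ennreal (R t) * indicator {0<..} t)) A" .
qed simp

section \<open>The density in the two finite regimes\<close>

text \<open>
  The regime of limit ratio \<open>0\<close>: the rescaled gaps \<open>\<epsilon> * p\<close> fill the half-line, \<open>h s = s\<close>, and the last factor
  is the constant density.
\<close>

lemma level_integral_linear:
  fixes a t :: real
  assumes a: "0 < a" "a < 1" and t: "0 < t"
  shows "(\<integral>\<^sup>+s. ennreal ((a * s) powr (1 / (1 - a))) * indicator {s. 0 < s \<and> a * s \<le> t} s \<partial>lborel)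
       = ennreal ((1 - a) * t powr ((2 - a) / (1 - a)) * (1 / (a * (2 - a))))"
proof -
  define g where "g = 1 / (1 - a)"
  have g: "0 < g" "(2 - a) / (1 - a) = g + 1" "1 - a = 1 / g" "2 - a = (g + 1) / g"
    using a by (simp_all add: g_def field_simps)
  have "((\<lambda>s. a powr g * s powr g) has_integral a powr g * ((t / a) powr (g + 1) / (g + 1))) {0..t / a}"
    using g a t by (intro has_integral_mult_right has_integral_powr_from_0) auto
  then have "(\<integral>\<^sup>+s. ennreal (a powr g * s powr g) * indicator {0..t / a} s \<partial>lborel)
      = ennreal (a powr g * ((t / a) powr (g + 1) / (g + 1)))"
    by (intro nn_integral_has_integral_lebesgue') auto
  moreover have "(\<integral>\<^sup>+s. ennreal ((a * s) powr g) * indicator {s. 0 < s \<and> a * s \<le> t} s \<partial>lborel)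
      = (\<integral>\<^sup>+s. ennreal (a powr g * s powr g) * indicator {0..t / a} s \<partial>lborel)"
  proof (intro nn_integral_cong)
    fix s :: real
    show "ennreal ((a * s) powr g) * indicator {s. 0 < s \<and> a * s \<le> t} s
        = ennreal (a powr g * s powr g) * indicator {0..t / a} s"
      using a by (cases "s = 0") (auto simp: indicator_def powr_mult field_simps)
  qed
  moreover have "a powr g * ((t / a) powr (g + 1) / (g + 1)) = 1 / g * t powr (g + 1) * (1 / (a * ((g + 1) / g)))"
    using a t g(1) by (simp add: powr_divide powr_add)
  ultimately show ?thesis
    unfolding g(2) unfolding g(4) unfolding g(3) using g(1) by simp
qed

text \<open>
  The regime of positive finite ratio \<open>l\<close>: the rescaled gaps \<open>\<epsilon> * p\<close> stay near the multiples of \<open>l\<close>, so \<open>h\<close> is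
  a step function with steps of length \<open>l\<close>. The level set \<open>{s. 0 < s \<and> a * h s \<le> t}\<close> consists of the first
  \<open>\<lfloor>t / (a * l)\<rfloor>\<close> steps, and each step contributes one term of the sum in \<^const>\<open>rho\<close>.
\<close>

lemma level_integral_step:
  fixes a l t :: real
  assumes a: "0 < a" "a < 1" and l: "0 < l" and t: "0 < t"
  shows "(\<integral>\<^sup>+s. ennreal ((a * (l * real_of_int \<lceil>s / l\<rceil>)) powr (1 / (1 - a))) *
        indicator {s. 0 < s \<and> a * (l * real_of_int \<lceil>s / l\<rceil>) \<le> t} s \<partial>lborel)
     = ennreal ((1 - a) * t powr ((2 - a) / (1 - a)) * rho a (ennreal l) t)"
proof -
  define g where "g = 1 / (1 - a)"
  define K where "K = nat \<lfloor>t / (a * l)\<rfloor>"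
  have g: "(2 - a) / (1 - a) = g + 1"
    using a by (simp add: g_def field_simps)
  have K: "p \<le> K \<longleftrightarrow> a * (l * real p) \<le> t" for p
  proof -
    have "p \<le> K \<longleftrightarrow> int p \<le> \<lfloor>t / (a * l)\<rfloor>" using a l t by (auto simp: K_def le_nat_iff)
    also have "\<dots> \<longleftrightarrow> real p \<le> t / (a * l)" by (simp add: le_floor_iff)
    also have "\<dots> \<longleftrightarrow> a * (l * real p) \<le> t" using a l by (simp add: field_simps)
    finally show ?thesis .
  qed
  have "(\<integral>\<^sup>+s. ennreal ((a * (l * real_of_int \<lceil>s / l\<rceil>)) powr g) *
        indicator {s. 0 < s \<and> a * (l * real_of_int \<lceil>s / l\<rceil>) \<le> t} s \<partial>lborel)
     = (\<integral>\<^sup>+s. (\<Sum>p=1..K. ennreal ((a * (l * real p)) powr g) * indicator {(real p - 1) * l<..real p * l} s) \<partial>lborel)"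
  proof (intro nn_integral_cong)
    fix s :: real
    define q where "q = nat \<lceil>s / l\<rceil>"
    have cell: "((real p - 1) * l < s \<and> s \<le> real p * l) \<longleftrightarrow> 0 < s \<and> p = q" if "p \<in> {1..K}" for p
    proof -
      have "0 < s \<and> p = q \<longleftrightarrow> \<lceil>s / l\<rceil> = int p"
      proof
        assume "\<lceil>s / l\<rceil> = int p"
        moreover from this that have "0 < \<lceil>s / l\<rceil>" by auto
        then have "0 < s" using l by (simp add: zero_less_divide_iff)
        ultimately show "0 < s \<and> p = q" by (simp add: q_def)
      qed (use that in \<open>auto simp: q_def\<close>)
      also have "\<dots> \<longleftrightarrow> real p - 1 < s / l \<and> s / l \<le> real p" by (simp add: ceiling_eq_iff)
      also have "\<dots> \<longleftrightarrow> (real p - 1) * l < s \<and> s \<le> real p * l" using l by (simp add: field_simps)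
      finally show ?thesis by simp
    qed
    have "(\<Sum>p=1..K. ennreal ((a * (l * real p)) powr g) * indicator {(real p - 1) * l<..real p * l} s)
      = (\<Sum>p=1..K. if p = q then (if 0 < s then ennreal ((a * (l * real p)) powr g) else 0) else 0)"
      by (intro sum.cong refl) (auto simp: indicator_def cell)
    also have "\<dots> = (if 0 < s \<and> q \<in> {1..K} then ennreal ((a * (l * real q)) powr g) else 0)"
      by (subst sum.delta) auto
    also have "\<dots> = ennreal ((a * (l * real_of_int \<lceil>s / l\<rceil>)) powr g) *
        indicator {s. 0 < s \<and> a * (l * real_of_int \<lceil>s / l\<rceil>) \<le> t} s"
    proof (cases "0 < s")
      case True
      then have "0 < s / l" using l by simp
      then have q: "0 < \<lceil>s / l\<rceil>" by linarith
      then have "real_of_int \<lceil>s / l\<rceil> = real q" "1 \<le> q" unfolding q_def by linarith+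
      then show ?thesis using True by (simp add: K)
    qed simp
    finally show "ennreal ((a * (l * real_of_int \<lceil>s / l\<rceil>)) powr g) *
        indicator {s. 0 < s \<and> a * (l * real_of_int \<lceil>s / l\<rceil>) \<le> t} s =
      (\<Sum>p=1..K. ennreal ((a * (l * real p)) powr g) * indicator {(real p - 1) * l<..real p * l} s)" ..
  qed
  also have "\<dots> = (\<Sum>p=1..K. ennreal ((a * (l * real p)) powr g) * ennreal l)"
    using l by (subst nn_integral_sum) (auto simp: nn_integral_cmult_indicator algebra_simps)
  also have "\<dots> = ennreal (\<Sum>p=1..K. (a * (l * real p)) powr g * l)"
    using l by (simp add: ennreal_mult' sum_ennreal[symmetric])
  also have "(\<Sum>p=1..K. (a * (l * real p)) powr g * l) = a powr g * l powr (g + 1) * (\<Sum>p=1..K. real p powr g)"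
    using a l by (simp add: powr_mult powr_add sum_distrib_left mult_ac)
  also have "\<dots> = (1 - a) * t powr ((2 - a) / (1 - a)) * rho a (ennreal l) t"
  proof -
    have "(t / l) powr (- (g + 1)) = l powr (g + 1) / t powr (g + 1)"
      unfolding powr_minus using l t by (simp add: powr_divide)
    then show ?thesis
      using a l t unfolding g by (simp add: rho_def g K_def flip: g_def)
  qed
  finally show ?thesis by (simp add: g_def)
qed

lemma rho_nonneg: "0 < a \<Longrightarrow> a < 1 \<Longrightarrow> 0 \<le> rho a lam t"
  by (auto simp: rho_def Let_def intro!: mult_nonneg_nonneg sum_nonneg divide_nonneg_nonneg)

lemma rho_even: "rho a lam (- t) = rho a lam t"
  by (simp add: rho_def)

lemma rho_measurable [measurable]: "rho a lam \<in> borel_measurable borel"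
proof -
  \<comment> \<open>The sum is a function of the integer \<open>\<lfloor>\<bar>t\<bar> / (a * enn2real lam)\<rfloor>\<close>, and every function on the discrete space of integers is measurable.\<close>
  define S where "S = (\<lambda>k. \<Sum>p = 1..nat k. real p powr (1 / (1 - a)))"
  have S: "(\<lambda>t. S \<lfloor>\<bar>t\<bar> / (a * enn2real lam)\<rfloor>) \<in> borel_measurable borel"
    by (rule measurable_compose[of _ borel "count_space UNIV" S borel]) simp_all
  show ?thesis
  proof (cases "lam = \<infinity> \<or> lam = 0")
    case True
    then show ?thesis by (auto simp: rho_def[abs_def])
  next
    case False
    then have "rho a lam = (\<lambda>t. a powr (1 / (1 - a)) / (1 - a) *
        (\<bar>t\<bar> / enn2real lam) powr (- ((2 - a) / (1 - a))) * S \<lfloor>\<bar>t\<bar> / (a * enn2real lam)\<rfloor>)"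
      by (simp add: rho_def fun_eq_iff Let_def S_def)
    also have "\<dots> \<in> borel_measurable borel"
      by (intro borel_measurable_times S) measurable
    finally show ?thesis .
  qed
qed

text \<open>
  The pairs with \<open>n < m\<close> are the mirror images of those with \<open>m < n\<close>; this is the corresponding
  splitting of the limit measure, where the origin has no mass.
\<close>

lemma integral_density_even:
  fixes f :: "real \<Rightarrow> complex" and R :: "real \<Rightarrow> real"
  assumes R [measurable]: "R \<in> borel_measurable borel" and R0: "\<And>t. 0 \<le> R t" and even: "\<And>t. R (- t) = R t"
    and f [measurable]: "f \<in> borel_measurable borel"
  defines "D \<equiv> density lborel (\<lambda>t. ennreal (R t) * indicator {0<..} t)"
  assumes i1: "integrable D f" and i2: "integrable D (\<lambda>t. f (- t))"
  shows "integrable (density lborel R) f"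
    and "integral\<^sup>L (density lborel R) f = integral\<^sup>L D f + integral\<^sup>L D (\<lambda>t. f (- t))"
proof -
  have D: "D = density lborel (\<lambda>t. R t * indicator {0<..} t)"
    unfolding D_def by (rule arg_cong[of _ _ "density lborel"]) (auto simp: indicator_def)
  have i: "integrable lborel (\<lambda>t. (R t * indicator {0<..} t) *\<^sub>R g t)"
    and v: "integral\<^sup>L D g = integral\<^sup>L lborel (\<lambda>t. (R t * indicator {0<..} t) *\<^sub>R g t)"
    if "integrable D g" and [measurable]: "g \<in> borel_measurable borel" for g :: "real \<Rightarrow> complex"
  proof -
    show "integrable lborel (\<lambda>t. (R t * indicator {0<..} t) *\<^sub>R g t)"
      using that(1) unfolding D by (subst (asm) integrable_density) (auto simp: R0)
    show "integral\<^sup>L D g = integral\<^sup>L lborel (\<lambda>t. (R t * indicator {0<..} t) *\<^sub>R g t)"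
      unfolding D by (subst integral_density) (auto simp: R0)
  qed
  let ?P = "\<lambda>t. (R t * indicator {0<..} t) *\<^sub>R f t" and ?M = "\<lambda>t. (R t * indicator {..<0} t) *\<^sub>R f t"
  have P: "integrable lborel ?P" by (rule i[OF i1]) measurable
  have refl: "(R (0 + -1 * t) * indicator {0<..} (0 + -1 * t)) *\<^sub>R f (- (0 + -1 * t)) = ?M t" for t
    by (simp add: even indicator_def)
  have M0: "integrable lborel (\<lambda>t. (R t * indicator {0<..} t) *\<^sub>R f (- t))"
    by (rule i[OF i2]) measurable
  from lborel_integrable_real_affine[OF M0, of "-1" 0] have M: "integrable lborel ?M"
    by (simp only: refl)
  have "integral\<^sup>L D (\<lambda>t. f (- t)) = integral\<^sup>L lborel (\<lambda>t. (R t * indicator {0<..} t) *\<^sub>R f (- t))"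
    by (rule v[OF i2]) measurable
  also have "\<dots> = \<bar>-1\<bar> *\<^sub>R integral\<^sup>L lborel
      (\<lambda>t. (R (0 + -1 * t) * indicator {0<..} (0 + -1 * t)) *\<^sub>R f (- (0 + -1 * t)))"
    by (rule lborel_integral_real_affine) simp
  also have "\<dots> = integral\<^sup>L lborel ?M"
    by (simp only: refl) simp
  finally have M': "integral\<^sup>L D (\<lambda>t. f (- t)) = integral\<^sup>L lborel ?M" .
  have ae: "AE t in lborel. ?P t + ?M t = R t *\<^sub>R f t"
    by (rule AE_mp[OF AE_lborel_singleton[of 0] AE_I2]) (auto simp: indicator_def)
  have "integrable lborel (\<lambda>t. R t *\<^sub>R f t)"
    by (rule integrable_cong_AE_imp[OF Bochner_Integration.integrable_add[OF P M] _ ae]) measurable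
  then show "integrable (density lborel R) f"
    by (subst integrable_density) (auto simp: R0)
  have "integral\<^sup>L (density lborel R) f = integral\<^sup>L lborel (\<lambda>t. R t *\<^sub>R f t)"
    by (subst integral_density) (auto simp: R0)
  also have "\<dots> = integral\<^sup>L lborel (\<lambda>t. ?P t + ?M t)"
    by (rule integral_cong_AE[symmetric]) (use ae in auto)
  also have "\<dots> = integral\<^sup>L lborel ?P + integral\<^sup>L lborel ?M"
    by (rule Bochner_Integration.integral_add[OF P M])
  also have "integral\<^sup>L lborel ?P = integral\<^sup>L D f"
    by (rule v[OF i1, symmetric]) measurable
  finally show "integral\<^sup>L (density lborel R) f = integral\<^sup>L D f + integral\<^sup>L D (\<lambda>t. f (- t))"
    by (simp add: M')
qed

section \<open>Convergence of the rescaled differences\<close>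

text \<open>
  By the mean value theorem the rescaled difference has the form of the limit map
  \<open>(s, x) \<mapsto> a * h s * x powr (a - 1)\<close>, with \<open>e * p\<close> in place of \<open>h s\<close> and with an
  intermediate point between \<open>m / N\<close> and \<open>(m + p) / N\<close> in place of \<open>x\<close>.
\<close>

lemma scaled_powr_gap:
  fixes a e :: real and m p N :: nat
  assumes a: "0 < a" "a < 1" and "0 < m" "0 < p" "0 < N"
  obtains \<xi> where "real m / real N < \<xi>" "\<xi> < real (m + p) / real N"
    "e * real N powr (1 - a) * (real (m + p) powr a - real m powr a) = a * (e * real p) * \<xi> powr (a - 1)"
proof -
  have "\<exists>z. real m < z \<and> z < real (m + p) \<and>
      real (m + p) powr a - real m powr a = (real (m + p) - real m) * (a * z powr (a - 1))"
  proof (rule MVT2)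
    fix x assume "real m \<le> x"
    then show "((\<lambda>x. x powr a) has_real_derivative a * x powr (a - 1)) (at x)"
      using assms by (intro has_real_derivative_powr) auto
  qed (use assms in auto)
  then obtain z where z: "real m < z" "z < real (m + p)"
      "real (m + p) powr a - real m powr a = real p * (a * z powr (a - 1))"
    by auto
  have "real N powr (1 - a) * z powr (a - 1) = (z / real N) powr (a - 1)"
    using assms z by (simp add: powr_divide powr_diff field_simps)
  then have "e * real N powr (1 - a) * (real (m + p) powr a - real m powr a) = a * (e * real p) * (z / real N) powr (a - 1)"
    using z(3) by (simp add: mult_ac)
  moreover have "real m / real N < z / real N" "z / real N < real (m + p) / real N"
    using z assms by (simp_all add: divide_strict_right_mono)
  ultimately show ?thesis using that by blast
qed

text \<open>
  The intermediate point is at most \<open>1\<close> and its exponent \<open>a - 1\<close> is negative. This bound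
  confines \<open>e * p\<close>, for the pairs that a compactly supported function sees, to a range independent of \<open>N\<close>.
\<close>

lemma scaled_powr_gap_ge:
  fixes a e :: real and m p N :: nat
  assumes a: "0 < a" "a < 1" and "0 < m" "0 < p" "m + p \<le> N" "0 \<le> e"
  shows "a * (e * real p) \<le> e * real N powr (1 - a) * (real (m + p) powr a - real m powr a)"
proof -
  have N: "0 < N" using assms by linarith
  obtain \<xi> where \<xi>: "real m / real N < \<xi>" "\<xi> < real (m + p) / real N"
    "e * real N powr (1 - a) * (real (m + p) powr a - real m powr a) = a * (e * real p) * \<xi> powr (a - 1)"
    using scaled_powr_gap[OF a assms(3,4) N] by metis
  have "0 < \<xi>" using \<xi>(1) by (rule le_less_trans[rotated]) simp
  moreover have "real (m + p) / real N \<le> 1" using N assms by simp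
  then have "\<xi> \<le> 1" using \<xi>(2) by linarith
  ultimately have "1 \<le> \<xi> powr (a - 1)"
    using a powr_le1[of "1 - a" \<xi>] by (simp add: powr_diff one_le_inverse_iff field_simps)
  then have "a * (e * real p) * 1 \<le> a * (e * real p) * \<xi> powr (a - 1)"
    using assms by (intro mult_left_mono) auto
  then show ?thesis by (simp only: \<xi>(3) mult_1_right)
qed

text \<open>
  The contribution of the pair \<open>(m + p, m)\<close>, in terms of the ratio \<open>e = \<phi> N / N powr (1 - a)\<close>
  instead of the scaling factor \<open>\<phi> N\<close>. The value \<open>0\<close> for \<open>m + p > N\<close> lets \<open>p\<close> and \<open>m\<close> range
  over a full rectangle.
\<close>

definition gap_value :: "real \<Rightarrow> (real \<Rightarrow> complex) \<Rightarrow> real \<Rightarrow> nat \<Rightarrow> nat \<Rightarrow> nat \<Rightarrow> complex" where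
  "gap_value a f e N p m =
    (if m + p \<le> N then f (e * real N powr (1 - a) * (real (m + p) powr a - real m powr a)) else 0)"

text \<open>
  The index \<open>m\<close> is close to \<open>x * N\<close>, whereas \<open>p\<close> is only of order \<open>1 / \<epsilon> N\<close>, which is \<open>o(N)\<close> by
  the hypothesis \<open>large\<close>. So the intermediate point tends to \<open>x\<close>, and since \<open>x < 1\<close> the constraint
  \<open>m + p \<le> N\<close> eventually holds.
\<close>

lemma gap_value_tendsto:
  fixes \<epsilon> :: "nat \<Rightarrow> real" and f :: "real \<Rightarrow> complex"
  assumes a: "0 < a" "a < 1" and pos: "\<And>N. 1 \<le> N \<Longrightarrow> 0 < \<epsilon> N"
    and large: "filterlim (\<lambda>N. \<epsilon> N * real N) at_top sequentially"
    and H: "(\<lambda>N. \<epsilon> N * real (nat \<lceil>s / \<epsilon> N\<rceil>)) \<longlonglongrightarrow> H"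
    and s: "0 < s" and x: "0 < x" "x < 1" and f: "continuous_on UNIV f"
  shows "(\<lambda>N. gap_value a f (\<epsilon> N) N (nat \<lceil>s / \<epsilon> N\<rceil>) (nat \<lceil>x * real N\<rceil>)) \<longlonglongrightarrow> f (a * H * x powr (a - 1))"
proof -
  define p where "p N = nat \<lceil>s / \<epsilon> N\<rceil>" for N
  define m where "m N = nat \<lceil>x * real N\<rceil>" for N
  have ev1: "\<forall>\<^sub>F N in sequentially. 1 \<le> N" by (rule eventually_ge_at_top)
  have p1: "0 < p N" if "1 \<le> N" for N
  proof -
    have "0 < s / \<epsilon> N" using s pos[OF that] by simp
    then show ?thesis unfolding p_def by linarith
  qed
  have m1: "0 < m N" if "1 \<le> N" for N
  proof -
    have "0 < x * real N" using x that by simp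
    then show ?thesis unfolding m_def by linarith
  qed
  have m: "(\<lambda>N. real (m N) / real N) \<longlonglongrightarrow> x"
  proof (rule real_tendsto_sandwich)
    have "x * real N \<le> real (m N) \<and> real (m N) \<le> x * real N + 1" for N
      using x mult_nonneg_nonneg[of x "real N"] unfolding m_def by linarith
    then show "\<forall>\<^sub>F N in sequentially. x \<le> real (m N) / real N"
        "\<forall>\<^sub>F N in sequentially. real (m N) / real N \<le> x + 1 / real N"
      by (auto intro!: eventually_sequentiallyI[of 1] simp: field_simps)
    show "(\<lambda>N. x + 1 / real N) \<longlonglongrightarrow> x"
      using tendsto_add[OF tendsto_const lim_1_over_n] by simp
  qed simp
  have "(\<lambda>N. \<epsilon> N * real (p N) / (\<epsilon> N * real N)) \<longlonglongrightarrow> 0"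
    using H large unfolding p_def by (intro tendsto_divide_0[OF _ filterlim_at_top_imp_at_infinity])
  then have "(\<lambda>N. real (p N) / real N) \<longlonglongrightarrow> 0"
  proof (rule Lim_transform_eventually)
    show "\<forall>\<^sub>F N in sequentially. \<epsilon> N * real (p N) / (\<epsilon> N * real N) = real (p N) / real N"
      using ev1 by (rule eventually_mono) (use pos in force)
  qed
  from tendsto_add[OF m this] have mp: "(\<lambda>N. real (m N + p N) / real N) \<longlonglongrightarrow> x"
    by (simp add: add_divide_distrib)
  have "\<forall>N. \<exists>\<xi>. 1 \<le> N \<longrightarrow> real (m N) / real N < \<xi> \<and> \<xi> < real (m N + p N) / real N \<and>
      \<epsilon> N * real N powr (1 - a) * (real (m N + p N) powr a - real (m N) powr a)
        = a * (\<epsilon> N * real (p N)) * \<xi> powr (a - 1)"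
  proof (rule allI)
    fix N :: nat
    show "\<exists>\<xi>. 1 \<le> N \<longrightarrow> real (m N) / real N < \<xi> \<and> \<xi> < real (m N + p N) / real N \<and>
      \<epsilon> N * real N powr (1 - a) * (real (m N + p N) powr a - real (m N) powr a)
        = a * (\<epsilon> N * real (p N)) * \<xi> powr (a - 1)"
    proof (cases "1 \<le> N")
      case True
      then have "0 < N" by simp
      from scaled_powr_gap[OF a m1[OF True] p1[OF True] this, of "\<epsilon> N"] show ?thesis by metis
    qed simp
  qed
  then obtain \<xi> where \<xi>: "\<And>N. 1 \<le> N \<Longrightarrow> real (m N) / real N < \<xi> N"
      "\<And>N. 1 \<le> N \<Longrightarrow> \<xi> N < real (m N + p N) / real N"
      "\<And>N. 1 \<le> N \<Longrightarrow> \<epsilon> N * real N powr (1 - a) * (real (m N + p N) powr a - real (m N) powr a)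
        = a * (\<epsilon> N * real (p N)) * \<xi> N powr (a - 1)"
    by metis
  have "\<xi> \<longlonglongrightarrow> x"
    by (rule real_tendsto_sandwich[OF _ _ m mp]) (auto intro!: eventually_sequentiallyI[of 1] less_imp_le dest: \<xi>(1,2))
  then have "(\<lambda>N. a * (\<epsilon> N * real (p N)) * \<xi> N powr (a - 1)) \<longlonglongrightarrow> a * H * x powr (a - 1)"
    using H x unfolding p_def by (intro tendsto_intros) auto
  then have lim: "(\<lambda>N. f (a * (\<epsilon> N * real (p N)) * \<xi> N powr (a - 1))) \<longlonglongrightarrow> f (a * H * x powr (a - 1))"
    by (rule isCont_tendsto_compose[rotated]) (use f in \<open>simp add: continuous_on_eq_continuous_at\<close>)
  have "\<forall>\<^sub>F N in sequentially. real (m N + p N) / real N < 1"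
    by (rule order_tendstoD(2)[OF mp]) (use x in simp)
  then have "\<forall>\<^sub>F N in sequentially. f (a * (\<epsilon> N * real (p N)) * \<xi> N powr (a - 1))
      = gap_value a f (\<epsilon> N) N (p N) (m N)"
    using ev1
  proof eventually_elim
    case (elim N)
    then have "real (m N + p N) < real N" by (simp add: divide_less_eq)
    then have "m N + p N \<le> N" by linarith
    then show ?case by (simp only: gap_value_def \<xi>(3)[OF elim(2)] if_True)
  qed
  then show ?thesis
    using Lim_transform_eventually[OF lim] by (simp add: p_def m_def)
qed

lemma sum_pairs_eq_cells:
  "(\<Sum>p=1..N. \<Sum>m=1..N. gap_value a f e N p m) =
    (\<Sum>(n, m)\<in>{(n, m). n \<in> {1..N} \<and> m \<in> {1..N} \<and> m < n}.
      f (e * real N powr (1 - a) * (real n powr a - real m powr a)))"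
proof -
  have "(\<Sum>p=1..N. \<Sum>m=1..N. gap_value a f e N p m) =
      (\<Sum>(p, m)\<in>{1..N} \<times> {1..N}. gap_value a f e N p m)"
    by (rule sum.cartesian_product)
  also have "\<dots> = (\<Sum>(p, m)\<in>{(p, m). p \<in> {1..N} \<and> m \<in> {1..N} \<and> m + p \<le> N}. gap_value a f e N p m)"
    by (rule sum.mono_neutral_right) (auto simp: gap_value_def split: if_splits)
  also have "\<dots> = (\<Sum>(n, m)\<in>{(n, m). n \<in> {1..N} \<and> m \<in> {1..N} \<and> m < n}.
      f (e * real N powr (1 - a) * (real n powr a - real m powr a)))"
    by (rule sum.reindex_bij_witness[of _ "\<lambda>(n, m). (n - m, m)" "\<lambda>(p, m). (m + p, m)"])
      (auto simp: gap_value_def)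
  finally show ?thesis .
qed

lemma AE_strip:
  assumes Z: "Z \<in> null_sets lborel" and P: "\<And>s x. 0 < s \<Longrightarrow> s \<notin> Z \<Longrightarrow> 0 < x \<Longrightarrow> x < 1 \<Longrightarrow> P (s, x)"
  shows "AE z in strip. P z"
proof -
  have null: "A \<times> B \<in> null_sets (lborel \<Otimes>\<^sub>M lborel :: (real \<times> real) measure)"
    if A: "A \<in> sets lborel" and B: "B \<in> sets lborel" and 0: "emeasure lborel A = 0 \<or> emeasure lborel B = 0" for A B
    using lborel.emeasure_pair_measure_Times[OF A B] A B 0 by (intro null_setsI) auto
  have 1: "Z \<times> UNIV \<in> null_sets (lborel \<Otimes>\<^sub>M lborel :: (real \<times> real) measure)"
    using Z by (intro null) auto
  have 2: "UNIV \<times> {1} \<in> null_sets (lborel \<Otimes>\<^sub>M lborel :: (real \<times> real) measure)"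
    by (intro null) auto
  have "AE z in (lborel :: (real \<times> real) measure). z \<notin> Z \<times> UNIV \<and> z \<notin> UNIV \<times> {1}"
    using AE_not_in[OF 1] AE_not_in[OF 2] unfolding lborel_prod by eventually_elim simp
  then have "AE z in lborel. z \<in> {0<..} \<times> {0<..1} \<longrightarrow> P z"
  proof eventually_elim
    case (elim z)
    then show ?case using P[of "fst z" "snd z"] by (cases z) (auto simp: less_le)
  qed
  then show ?thesis
    unfolding strip_def by (subst AE_restrict_space_iff) auto
qed

text \<open>
  Dominated convergence on the strip. If \<open>f\<close> is bounded by \<open>B\<close> and vanishes outside \<open>[-A, A]\<close>, then
  \<open>s \<le> \<epsilon> N * p\<close> and the lower bound \<open>a * (\<epsilon> N * p)\<close> on the rescaled differences force \<open>s \<le> A / a\<close> wherever the integrand is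
  nonzero, so \<open>B\<close> times the indicator of a bounded rectangle dominates. The exceptional null set \<open>Z\<close> accounts for
  the discontinuities of the ceiling.
\<close>

lemma integral_cells_tendsto:
  fixes \<epsilon> h :: "_ \<Rightarrow> real" and f :: "real \<Rightarrow> complex"
  assumes a: "0 < a" "a < 1" and pos: "\<And>N. 1 \<le> N \<Longrightarrow> 0 < \<epsilon> N"
    and large: "filterlim (\<lambda>N. \<epsilon> N * real N) at_top sequentially"
    and h: "h \<in> borel_measurable borel" and Z: "Z \<in> null_sets lborel"
    and H: "\<And>s. 0 < s \<Longrightarrow> s \<notin> Z \<Longrightarrow> (\<lambda>N. \<epsilon> N * real (nat \<lceil>s / \<epsilon> N\<rceil>)) \<longlonglongrightarrow> h s"
    and f: "continuous_on UNIV f" and bnd: "\<And>t. norm (f t) \<le> B" and supp: "\<And>t. A < \<bar>t\<bar> \<Longrightarrow> f t = 0"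
    and A: "0 < A"
  shows "integrable strip (\<lambda>(s, x). f (a * h s * x powr (a - 1)))"
    and "(\<lambda>N. (\<epsilon> N / real N) *\<^sub>R (\<Sum>p=1..N. \<Sum>m=1..N. gap_value a f (\<epsilon> N) N p m))
      \<longlonglongrightarrow> integral\<^sup>L strip (\<lambda>(s, x). f (a * h s * x powr (a - 1)))"
proof -
  define T where "T = (\<lambda>(s, x). a * h s * x powr (a - 1))"
  define u where "u N = (\<lambda>(s, x). gap_value a f (\<epsilon> N) N (nat \<lceil>s / \<epsilon> N\<rceil>) (nat \<lceil>x * real N\<rceil>))" for N
  define w where "w z = indicator ({0<..A / a} \<times> {0<..1}) z *\<^sub>R B" for z :: "real \<times> real"
  have f_meas [measurable]: "f \<in> borel_measurable borel"
    using f by (rule borel_measurable_continuous_onI)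
  have "T \<in> borel_measurable borel"
    unfolding T_def borel_prod[symmetric] using h by measurable
  then have fT: "(\<lambda>z. f (T z)) \<in> borel_measurable strip"
    by (intro borel_measurable_strip) measurable
  have u: "integrable strip (u N)"
      "integral\<^sup>L strip (u N) = (\<epsilon> N / real N) *\<^sub>R (\<Sum>p=1..N. \<Sum>m=1..N. gap_value a f (\<epsilon> N) N p m)"
    if "1 \<le> N" for N
    unfolding u_def using integral_strip_cells[of "\<epsilon> N" N "gap_value a f (\<epsilon> N) N"] that pos[OF that]
    by (auto simp: gap_value_def)
  have w: "integrable strip w"
  proof -
    have "emeasure strip ({0<..A / a} \<times> {0<..1}) = ennreal ((A / a - 0) * (1 - 0))"
      using A a by (intro emeasure_strip_rectangle) auto
    moreover from this have "{0<..A / a} \<times> {0<..1} \<in> sets strip"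
      using A a by (intro emeasure_neq_0_sets) auto
    ultimately show ?thesis
      unfolding w_def by (intro integrable_scaleR_left integrable_real_indicator) auto
  qed
  have B: "0 \<le> B" using bnd[of 0] norm_ge_zero[of "f 0"] by linarith
  have dom: "AE z in strip. norm (u N z) \<le> w z" if N: "1 \<le> N" for N
  proof (rule AE_strip[OF Z])
    fix s x :: real assume sx: "0 < s" "0 < x" "x < 1"
    define p m where "p = nat \<lceil>s / \<epsilon> N\<rceil>" and "m = nat \<lceil>x * real N\<rceil>"
    have e: "0 < \<epsilon> N" using pos[OF N] .
    have "0 < s / \<epsilon> N" "0 < x * real N" using sx e N by auto
    then have pm: "0 < p" "0 < m" "s / \<epsilon> N \<le> real p" unfolding p_def m_def by linarith+
    have "u N (s, x) = 0" if big: "A / a < s"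
    proof (cases "m + p \<le> N")
      case True
      have "A < a * s" using big a by (simp add: field_simps)
      also have "s \<le> \<epsilon> N * real p" using pm(3) e by (simp add: field_simps)
      then have "a * s \<le> a * (\<epsilon> N * real p)" using a by (intro mult_left_mono) auto
      also have "\<dots> \<le> \<epsilon> N * real N powr (1 - a) * (real (m + p) powr a - real m powr a)"
        using scaled_powr_gap_ge[OF a pm(2,1) True] e by simp
      finally have "A < \<bar>\<epsilon> N * real N powr (1 - a) * (real (m + p) powr a - real m powr a)\<bar>" by linarith
      from supp[OF this] show ?thesis
        by (simp add: u_def gap_value_def p_def m_def)
    qed (simp add: u_def gap_value_def p_def m_def)
    moreover have "norm (u N (s, x)) \<le> B"
      using bnd B by (simp add: u_def gap_value_def)
    ultimately show "norm (u N (s, x)) \<le> w (s, x)"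
      using sx by (auto simp: w_def indicator_def not_le)
  qed
  \<comment> \<open>Shifted by one, because \<open>\<epsilon> 0\<close> is arbitrary and \<open>u 0\<close> need not be dominated.\<close>
  have conv: "AE z in strip. (\<lambda>k. u (Suc k) z) \<longlonglongrightarrow> f (T z)"
  proof (rule AE_strip[OF Z])
    fix s x :: real assume sx: "0 < s" "s \<notin> Z" "0 < x" "x < 1"
    have "(\<lambda>N. u N (s, x)) \<longlonglongrightarrow> f (T (s, x))"
      unfolding u_def T_def using gap_value_tendsto[OF a pos large H[OF sx(1,2)] sx(1,3,4) f] by simp
    then show "(\<lambda>k. u (Suc k) (s, x)) \<longlonglongrightarrow> f (T (s, x))"
      by (rule LIMSEQ_Suc)
  qed
  have um: "u (Suc k) \<in> borel_measurable strip" for k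
    using u(1)[of "Suc k"] by simp
  have "integrable strip (\<lambda>z. f (T z))"
    by (rule integrable_dominated_convergence[OF fT um w conv]) (rule dom, simp)
  then show "integrable strip (\<lambda>(s, x). f (a * h s * x powr (a - 1)))"
    by (simp add: T_def case_prod_unfold)
  have "(\<lambda>k. integral\<^sup>L strip (u (Suc k))) \<longlonglongrightarrow> integral\<^sup>L strip (\<lambda>z. f (T z))"
    by (rule integral_dominated_convergence[OF fT um w conv]) (rule dom, simp)
  then have "(\<lambda>N. (\<epsilon> N / real N) *\<^sub>R (\<Sum>p=1..N. \<Sum>m=1..N. gap_value a f (\<epsilon> N) N p m))
      \<longlonglongrightarrow> integral\<^sup>L strip (\<lambda>z. f (T z))"
    using u(2)[of "Suc k" for k] by (subst filterlim_sequentially_Suc[symmetric]) simp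
  then show "(\<lambda>N. (\<epsilon> N / real N) *\<^sub>R (\<Sum>p=1..N. \<Sum>m=1..N. gap_value a f (\<epsilon> N) N p m))
      \<longlonglongrightarrow> integral\<^sup>L strip (\<lambda>(s, x). f (a * h s * x powr (a - 1)))"
    by (simp add: T_def case_prod_unfold)
qed

lemma tendsto_step_zero:
  fixes \<epsilon> :: "nat \<Rightarrow> real"
  assumes pos: "\<And>N. 1 \<le> N \<Longrightarrow> 0 < \<epsilon> N" and lim: "\<epsilon> \<longlonglongrightarrow> 0" and s: "0 < s"
  shows "(\<lambda>N. \<epsilon> N * real (nat \<lceil>s / \<epsilon> N\<rceil>)) \<longlonglongrightarrow> s"
proof (rule real_tendsto_sandwich)
  have *: "s \<le> \<epsilon> N * real (nat \<lceil>s / \<epsilon> N\<rceil>)" "\<epsilon> N * real (nat \<lceil>s / \<epsilon> N\<rceil>) \<le> s + \<epsilon> N" if "1 \<le> N" for N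
  proof -
    have e: "0 < \<epsilon> N" by (rule pos[OF that])
    then have "0 < s / \<epsilon> N" using s by simp
    then have "s / \<epsilon> N \<le> real (nat \<lceil>s / \<epsilon> N\<rceil>)" "real (nat \<lceil>s / \<epsilon> N\<rceil>) \<le> s / \<epsilon> N + 1" by linarith+
    then show "s \<le> \<epsilon> N * real (nat \<lceil>s / \<epsilon> N\<rceil>)" "\<epsilon> N * real (nat \<lceil>s / \<epsilon> N\<rceil>) \<le> s + \<epsilon> N"
      using e by (simp_all add: field_simps)
  qed
  show "\<forall>\<^sub>F N in sequentially. s \<le> \<epsilon> N * real (nat \<lceil>s / \<epsilon> N\<rceil>)"
      "\<forall>\<^sub>F N in sequentially. \<epsilon> N * real (nat \<lceil>s / \<epsilon> N\<rceil>) \<le> s + \<epsilon> N"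
    using * by (auto intro: eventually_sequentiallyI[of 1])
  show "(\<lambda>N. s + \<epsilon> N) \<longlonglongrightarrow> s" using tendsto_add[OF tendsto_const lim] by simp
qed simp

text \<open>
  The ceiling is locally constant away from the integers, so \<open>\<lceil>s / \<epsilon> N\<rceil>\<close> is eventually equal to
  \<open>\<lceil>s / l\<rceil>\<close>.
\<close>

lemma tendsto_step_pos:
  fixes \<epsilon> :: "nat \<Rightarrow> real"
  assumes lim: "\<epsilon> \<longlonglongrightarrow> l" and l: "0 < l" and s: "0 < s" and nonint: "s / l \<notin> \<int>"
  shows "(\<lambda>N. \<epsilon> N * real (nat \<lceil>s / \<epsilon> N\<rceil>)) \<longlonglongrightarrow> l * real_of_int \<lceil>s / l\<rceil>"
proof -
  have q: "(\<lambda>N. s / \<epsilon> N) \<longlonglongrightarrow> s / l" using lim l by (intro tendsto_intros) auto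
  have sl: "0 < s / l" using s l by simp
  have "real_of_int \<lceil>s / l\<rceil> \<noteq> s / l" using nonint by (metis Ints_of_int)
  then have bds: "real_of_int \<lceil>s / l\<rceil> - 1 < s / l" "s / l < real_of_int \<lceil>s / l\<rceil>" by linarith+
  have "\<forall>\<^sub>F N in sequentially. \<epsilon> N * real_of_int \<lceil>s / l\<rceil> = \<epsilon> N * real (nat \<lceil>s / \<epsilon> N\<rceil>)"
    using order_tendstoD(1)[OF q bds(1)] order_tendstoD(2)[OF q bds(2)] order_tendstoD(1)[OF q sl]
  proof eventually_elim
    case (elim N)
    then have "\<lceil>s / \<epsilon> N\<rceil> = \<lceil>s / l\<rceil>" by (simp add: ceiling_eq_iff)
    moreover have "0 < \<lceil>s / l\<rceil>" using sl by linarith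
    ultimately show ?case by simp
  qed
  moreover have "(\<lambda>N. \<epsilon> N * real_of_int \<lceil>s / l\<rceil>) \<longlonglongrightarrow> l * real_of_int \<lceil>s / l\<rceil>"
    by (intro tendsto_intros lim)
  ultimately show ?thesis by (rule Lim_transform_eventually[rotated])
qed

section \<open>Vague convergence\<close>

lemma integral_pair_corr_measure_cells:
  fixes \<alpha> :: real and \<phi> :: "nat \<Rightarrow> real" and f :: "real \<Rightarrow> complex"
  assumes f: "f \<in> borel_measurable borel" and N: "1 \<le> N" and \<phi>: "0 < \<phi> N"
  defines "e \<equiv> \<phi> N / real N powr (1 - \<alpha>)"
  shows "integral\<^sup>L (pair_corr_measure \<alpha> \<phi> N) f =
    (e / real N) *\<^sub>R (\<Sum>p=1..N. \<Sum>m=1..N. gap_value \<alpha> f e N p m) +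
    (e / real N) *\<^sub>R (\<Sum>p=1..N. \<Sum>m=1..N. gap_value \<alpha> (\<lambda>t. f (- t)) e N p m)"
proof -
  let ?F = "\<lambda>n m. f (\<phi> N * (real n powr \<alpha> - real m powr \<alpha>))"
  let ?L = "{(n, m). n \<in> {1..N} \<and> m \<in> {1..N} \<and> m < n}"
  let ?U = "{(n, m). n \<in> {1..N} \<and> m \<in> {1..N} \<and> n < m}"
  have fin: "finite ?L" "finite ?U"
    by (rule finite_subset[of _ "{1..N} \<times> {1..N}"]; auto)+
  have \<phi>e: "e * real N powr (1 - \<alpha>) = \<phi> N"
    using N by (simp add: e_def)
  have \<psi>: "1 / renorm_factor \<alpha> \<phi> N = e / real N" "0 \<le> renorm_factor \<alpha> \<phi> N"
    using N \<phi> by (simp_all add: renorm_factor_def e_def powr_diff field_simps power2_eq_square)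
  have swap: "(\<Sum>(n, m)\<in>?U. ?F n m) = (\<Sum>(n, m)\<in>?L. f (- (\<phi> N * (real n powr \<alpha> - real m powr \<alpha>))))"
    by (rule sum.reindex_bij_witness[of _ prod.swap prod.swap]) (auto simp: algebra_simps)
  have "{(n, m). n \<in> {1..N} \<and> m \<in> {1..N} \<and> n \<noteq> m} = ?L \<union> ?U" by auto
  moreover have "(\<Sum>(n, m)\<in>?L \<union> ?U. ?F n m) = (\<Sum>(n, m)\<in>?L. ?F n m) + (\<Sum>(n, m)\<in>?U. ?F n m)"
    using fin by (intro sum.union_disjoint) auto
  ultimately have "integral\<^sup>L (pair_corr_measure \<alpha> \<phi> N) f = (e / real N) *\<^sub>R
      ((\<Sum>(n, m)\<in>?L. ?F n m) + (\<Sum>(n, m)\<in>?L. f (- (\<phi> N * (real n powr \<alpha> - real m powr \<alpha>)))))"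
    unfolding integral_pair_corr_measure(2)[OF f \<psi>(2)] \<psi>(1) by (simp only: swap)
  then show ?thesis
    unfolding sum_pairs_eq_cells \<phi>e by (simp only: scaleR_add_right)
qed

lemma compact_support_bounds:
  fixes f :: "real \<Rightarrow> complex"
  assumes f: "continuous_on UNIV f" and supp: "compact (closure {x. f x \<noteq> 0})"
  obtains A B where "0 < A" "\<And>t. A < \<bar>t\<bar> \<Longrightarrow> f t = 0" "\<And>t. norm (f t) \<le> B"
proof -
  have "bounded {x. f x \<noteq> 0}"
    using supp by (meson bounded_subset closure_subset compact_imp_bounded)
  then obtain A where A: "0 < A" "\<And>t. f t \<noteq> 0 \<Longrightarrow> \<bar>t\<bar> \<le> A"
    by (auto simp: bounded_pos)
  have "compact (f ` {- A..A})"
    by (rule compact_continuous_image[OF continuous_on_subset[OF f subset_UNIV] compact_Icc])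
  then obtain B where B0: "0 < B" "\<forall>z\<in>f ` {- A..A}. norm z \<le> B"
    using compact_imp_bounded bounded_pos by blast
  then have B: "norm (f t) \<le> B" if "\<bar>t\<bar> \<le> A" for t
    using that by (simp add: abs_le_iff)
  show ?thesis
  proof (rule that[OF A(1)])
    show "f t = 0" if "A < \<bar>t\<bar>" for t using A(2)[of t] that by linarith
    show "norm (f t) \<le> B" for t using A(2)[of t] B B0(1) by (cases "f t = 0") auto
  qed
qed

text \<open>
  The three regimes differ only in the limit \<open>h\<close> of \<open>\<epsilon> N * \<lceil>s / \<epsilon> N\<rceil>\<close>: it is \<open>s\<close> for ratio
  \<open>0\<close>, the step function \<open>l * \<lceil>s / l\<rceil>\<close> for a positive finite ratio \<open>l\<close>. For infinite ratio there is no limit,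
  but then even the rescaled differences with \<open>p = 1\<close> are at least \<open>a * \<epsilon> N\<close> and leave the support of \<open>f\<close>.
\<close>

lemma half_line_limit:
  fixes \<epsilon> :: "nat \<Rightarrow> real" and f :: "real \<Rightarrow> complex" and lam :: ennreal
  assumes a: "0 < a" "a < 1" and pos: "\<And>N. 1 \<le> N \<Longrightarrow> 0 < \<epsilon> N"
    and large: "filterlim (\<lambda>N. \<epsilon> N * real N) at_top sequentially"
    and lim: "(\<lambda>N. ennreal (\<epsilon> N)) \<longlonglongrightarrow> lam"
    and f: "continuous_on UNIV f" and bnd: "\<And>t. norm (f t) \<le> B" and supp: "\<And>t. A < \<bar>t\<bar> \<Longrightarrow> f t = 0"
    and A: "0 < A"
  defines "D \<equiv> density lborel (\<lambda>t. ennreal (rho a lam t) * indicator {0<..} t)"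
  shows "integrable D f"
    and "(\<lambda>N. (\<epsilon> N / real N) *\<^sub>R (\<Sum>p=1..N. \<Sum>m=1..N. gap_value a f (\<epsilon> N) N p m))
      \<longlonglongrightarrow> integral\<^sup>L D f"
proof -
  let ?S = "\<lambda>N. (\<epsilon> N / real N) *\<^sub>R (\<Sum>p=1..N. \<Sum>m=1..N. gap_value a f (\<epsilon> N) N p m)"
  have fm [measurable]: "f \<in> borel_measurable borel"
    using f by (rule borel_measurable_continuous_onI)
  have finite_case: "integrable D f \<and> ?S \<longlonglongrightarrow> integral\<^sup>L D f"
    if h [measurable]: "h \<in> borel_measurable borel" and hpos: "\<And>s. 0 < s \<Longrightarrow> 0 < h s"
      and Z: "Z \<in> null_sets lborel"
      and H: "\<And>s. 0 < s \<Longrightarrow> s \<notin> Z \<Longrightarrow> (\<lambda>N. \<epsilon> N * real (nat \<lceil>s / \<epsilon> N\<rceil>)) \<longlonglongrightarrow> h s"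
      and level: "\<And>t. 0 < t \<Longrightarrow>
      (\<integral>\<^sup>+s. ennreal ((a * h s) powr (1 / (1 - a))) * indicator {s. 0 < s \<and> a * h s \<le> t} s \<partial>lborel)
       = ennreal ((1 - a) * t powr ((2 - a) / (1 - a)) * rho a lam t)"
    for h :: "real \<Rightarrow> real" and Z
  proof -
    have D: "D = distr strip borel (\<lambda>(s, x). a * h s * x powr (a - 1))"
      unfolding D_def by (rule distr_strip_eq_density[OF a h hpos rho_measurable level, symmetric])
    have "(\<lambda>(s, x). a * h s * x powr (a - 1)) \<in> borel_measurable borel"
      unfolding borel_prod[symmetric] by measurable
    note T = borel_measurable_strip[OF this]
    note lims = integral_cells_tendsto[OF a pos large h Z H f bnd supp A]
    show ?thesis
      unfolding D integrable_distr_eq[OF T fm] integral_distr[OF T fm]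
      using lims by (simp add: case_prod_unfold)
  qed
  have "integrable D f \<and> ?S \<longlonglongrightarrow> integral\<^sup>L D f"
  proof (cases lam)
    case top
    have D: "D = null_measure lborel"
      unfolding D_def by (rule measure_eqI) (auto simp: emeasure_density rho_def top)
    have "\<forall>\<^sub>F N in sequentially. ennreal (A / a) < ennreal (\<epsilon> N)"
      by (rule order_tendstoD(1)[OF lim]) (simp add: top)
    then have "\<forall>\<^sub>F N in sequentially. ?S N = 0"
      using eventually_ge_at_top[of 1]
    proof eventually_elim
      case (elim N)
      have e: "0 < \<epsilon> N" by (rule pos[OF elim(2)])
      have "A / a < \<epsilon> N" using elim(1) A a e by (simp add: ennreal_less_iff)
      then have Ae: "A < a * \<epsilon> N" using a by (simp add: field_simps)
      have "gap_value a f (\<epsilon> N) N p m = 0" if "p \<in> {1..N}" "m \<in> {1..N}" for p m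
      proof (cases "m + p \<le> N")
        case True
        have "a * \<epsilon> N * 1 \<le> a * \<epsilon> N * real p"
          using that a e by (intro mult_left_mono) auto
        moreover have "a * (\<epsilon> N * real p) \<le> \<epsilon> N * real N powr (1 - a) * (real (m + p) powr a - real m powr a)"
          using that e by (intro scaled_powr_gap_ge[OF a _ _ True]) auto
        ultimately have "A < \<bar>\<epsilon> N * real N powr (1 - a) * (real (m + p) powr a - real m powr a)\<bar>"
          using Ae by (simp add: mult.assoc)
        from supp[OF this] show ?thesis by (simp add: gap_value_def)
      qed (simp add: gap_value_def)
      then show ?case by simp
    qed
    then have "?S \<longlonglongrightarrow> 0" by (rule tendsto_eventually)
    moreover have "integrable D f \<and> integral\<^sup>L D f = 0"
      using fm by (simp add: D integrable_null_measure_iff integral_null_measure)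
    ultimately show ?thesis by simp
  next
    case (real l)
    then have l: "0 \<le> l" "\<epsilon> \<longlonglongrightarrow> l"
      using lim pos by (auto intro!: tendsto_ennrealD eventually_sequentiallyI[of 1] simp: less_imp_le)
    show ?thesis
    proof (cases "l = 0")
      case True
      show ?thesis
      proof (rule finite_case[of "\<lambda>s. s" "{}"])
        fix t :: real assume "0 < t"
        then show "(\<integral>\<^sup>+s. ennreal ((a * s) powr (1 / (1 - a))) * indicator {s. 0 < s \<and> a * s \<le> t} s \<partial>lborel)
          = ennreal ((1 - a) * t powr ((2 - a) / (1 - a)) * rho a lam t)"
          using level_integral_linear[OF a] real True by (simp add: rho_def)
      next
        fix s :: real assume "0 < s"
        then show "(\<lambda>N. \<epsilon> N * real (nat \<lceil>s / \<epsilon> N\<rceil>)) \<longlonglongrightarrow> s"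
          using tendsto_step_zero[OF pos] l True by simp
      qed auto
    next
      case False
      with l have l0: "0 < l" by simp
      show ?thesis
      proof (rule finite_case[of "\<lambda>s. l * real_of_int \<lceil>s / l\<rceil>" "range (\<lambda>k. l * real_of_int k)"])
        fix s :: real assume s: "0 < s" "s \<notin> range (\<lambda>k. l * real_of_int k)"
        have "s / l \<notin> \<int>"
        proof
          assume "s / l \<in> \<int>"
          then obtain k where "s / l = real_of_int k" by (auto elim: Ints_cases)
          then have "s = l * real_of_int k" using l0 by (simp add: field_simps)
          with s(2) show False by blast
        qed
        then show "(\<lambda>N. \<epsilon> N * real (nat \<lceil>s / \<epsilon> N\<rceil>)) \<longlonglongrightarrow> l * real_of_int \<lceil>s / l\<rceil>"
          by (rule tendsto_step_pos[OF l(2) l0 s(1)])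
      next
        fix s :: real assume "0 < s"
        then have "0 < s / l" using l0 by simp
        then have "0 < \<lceil>s / l\<rceil>" by linarith
        then show "0 < l * real_of_int \<lceil>s / l\<rceil>" using l0 by simp
      next
        fix t :: real assume "0 < t"
        from level_integral_step[OF a l0 this]
        show "(\<integral>\<^sup>+s. ennreal ((a * (l * real_of_int \<lceil>s / l\<rceil>)) powr (1 / (1 - a))) *
            indicator {s. 0 < s \<and> a * (l * real_of_int \<lceil>s / l\<rceil>) \<le> t} s \<partial>lborel)
          = ennreal ((1 - a) * t powr ((2 - a) / (1 - a)) * rho a lam t)"
          by (simp only: real)
      qed (auto intro: countable_imp_null_set_lborel)
    qed
  qed
  then show "integrable D f" "?S \<longlonglongrightarrow> integral\<^sup>L D f" by auto
qed

theorem theorem2p1: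
  fixes \<alpha> :: real and \<phi> :: "nat \<Rightarrow> real" and lam :: ennreal
  assumes "0 < \<alpha>" and "\<alpha> < 1"
    and "\<And>N. 1 \<le> N \<Longrightarrow> 0 < \<phi> N"
    and "filterlim \<phi> at_top sequentially"
    and "filterlim (renorm_factor \<alpha> \<phi>) at_top sequentially"
    and "(\<lambda>N. ennreal (\<phi> N / real N powr (1 - \<alpha>))) \<longlonglongrightarrow> lam"
  shows "rho \<alpha> lam \<in> borel_measurable borel \<and> (\<forall>t. 0 \<le> rho \<alpha> lam t) \<and>
    vaguely_converges (pair_corr_measure \<alpha> \<phi>) (density lborel (\<lambda>t. ennreal (rho \<alpha> lam t)))"
proof (intro conjI allI)
  note a = assms(1,2) and \<phi>pos = assms(3) and \<phi>lim = assms(4) and lim = assms(6)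
  show "rho \<alpha> lam \<in> borel_measurable borel" by (rule rho_measurable)
  show nonneg: "0 \<le> rho \<alpha> lam t" for t by (rule rho_nonneg[OF a])
  define \<epsilon> where "\<epsilon> N = \<phi> N / real N powr (1 - \<alpha>)" for N
  have \<epsilon>pos: "0 < \<epsilon> N" if "1 \<le> N" for N
    using \<phi>pos[OF that] that by (simp add: \<epsilon>_def)
  \<comment> \<open>The divergence of \<open>\<phi>\<close> makes the gaps \<open>p\<close>, of order \<open>1 / \<epsilon> N\<close>, negligible against \<open>N\<close>.\<close>
  have "\<phi> N \<le> \<epsilon> N * real N" if "1 \<le> N" for N
  proof -
    have "\<epsilon> N * real N = \<phi> N * real N powr \<alpha>"
      using that by (simp add: \<epsilon>_def powr_diff)
    moreover have "1 \<le> real N powr \<alpha>"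
      using that a by (simp add: ge_one_powr_ge_zero)
    then have "\<phi> N * 1 \<le> \<phi> N * real N powr \<alpha>"
      using \<phi>pos[OF that] by (intro mult_left_mono) auto
    ultimately show ?thesis by simp
  qed
  then have large: "filterlim (\<lambda>N. \<epsilon> N * real N) at_top sequentially"
    by (intro filterlim_at_top_mono[OF \<phi>lim] eventually_sequentiallyI[of 1])
  note lim' = lim[folded \<epsilon>_def]
  show "vaguely_converges (pair_corr_measure \<alpha> \<phi>) (density lborel (\<lambda>t. ennreal (rho \<alpha> lam t)))"
    unfolding vaguely_converges_def
  proof (intro conjI allI impI; (elim conjE)?)
    show "sets (pair_corr_measure \<alpha> \<phi> N) = sets borel" for N
      by (simp add: pair_corr_measure_def)
  next
    fix f :: "real \<Rightarrow> complex"
    assume f: "continuous_on UNIV f" and supp: "compact (closure {x. f x \<noteq> 0})"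
    have fm: "f \<in> borel_measurable borel" using f by (rule borel_measurable_continuous_onI)
    obtain A B where AB: "0 < A" "\<And>t. A < \<bar>t\<bar> \<Longrightarrow> f t = 0" "\<And>t. norm (f t) \<le> B"
      using compact_support_bounds[OF f supp] by metis
    have f': "continuous_on UNIV (\<lambda>t. f (- t))"
      using f by (auto intro!: continuous_intros continuous_on_compose2[OF f])
    note h1 = half_line_limit[OF a \<epsilon>pos large lim' f AB(3,2,1)]
    have "f (- t) = 0" if "A < \<bar>t\<bar>" for t using AB(2)[of "- t"] that by simp
    note h2 = half_line_limit[OF a \<epsilon>pos large lim' f' AB(3) this AB(1)]
    note even = integral_density_even[OF rho_measurable nonneg rho_even fm h1(1)]
    show "integrable (density lborel (\<lambda>t. ennreal (rho \<alpha> lam t))) f"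
      using even(1) h2(1) by simp
    show "integrable (pair_corr_measure \<alpha> \<phi> N) f" for N
    proof (rule integral_pair_corr_measure(1)[OF fm])
      show "0 \<le> renorm_factor \<alpha> \<phi> N"
        using \<phi>pos[of N] by (cases "N = 0") (simp_all add: renorm_factor_def)
    qed
    have "(\<lambda>N. (\<epsilon> N / real N) *\<^sub>R (\<Sum>p=1..N. \<Sum>m=1..N. gap_value \<alpha> f (\<epsilon> N) N p m) +
        (\<epsilon> N / real N) *\<^sub>R (\<Sum>p=1..N. \<Sum>m=1..N. gap_value \<alpha> (\<lambda>t. f (- t)) (\<epsilon> N) N p m))
      \<longlonglongrightarrow> integral\<^sup>L (density lborel (\<lambda>t. ennreal (rho \<alpha> lam t))) f"
      using tendsto_add[OF h1(2) h2(2)] even(2) h2(1) by simp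
    then show "(\<lambda>N. integral\<^sup>L (pair_corr_measure \<alpha> \<phi> N) f)
        \<longlonglongrightarrow> integral\<^sup>L (density lborel (\<lambda>t. ennreal (rho \<alpha> lam t))) f"
    proof (rule Lim_transform_eventually)
      show "\<forall>\<^sub>F N in sequentially. (\<epsilon> N / real N) *\<^sub>R (\<Sum>p=1..N. \<Sum>m=1..N. gap_value \<alpha> f (\<epsilon> N) N p m) +
        (\<epsilon> N / real N) *\<^sub>R (\<Sum>p=1..N. \<Sum>m=1..N. gap_value \<alpha> (\<lambda>t. f (- t)) (\<epsilon> N) N p m)
        = integral\<^sup>L (pair_corr_measure \<alpha> \<phi> N) f"
        using integral_pair_corr_measure_cells[OF fm _ \<phi>pos]
        by (auto intro!: eventually_sequentiallyI[of 1] simp: \<epsilon>_def)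
    qed
  qed simp
qed

end
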